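(* Let $A$ and $B$ be subspaces of a topological space with underlying set $A\cup B$. If $A$ and $B$ are left-separated spaces, $t(A\cup B)=\omega$, and $\operatorname{ord}_\ell(A)+\operatorname{ord}_\ell(B)<\omega_1\cdot\omega$, then $A\cup B$ is left-separated and $\operatorname{ord}_\ell(A\cup B)<\omega_1\cdot\omega$.
   Context: A well-ordering $\prec$ of (the underlying set of) a topological space $X$ is left-separating if $\{x\in X: x\prec y\}$ is closed in $X$ for every $y\in X$. A space is left-separated if it has a left-separating well-ordering. For a left-separated space $X$, its left-separating type $\operatorname{ord}_\ell(X)$ is the minimum of the order types of the left-separating well-orderings of $X$. The condition $t(X)=\omega$ means that $X$ is countably tight: whenever $x\in\overline{H}$ with $H\subset X$, there is a countable $H'\subset H$ with $x\in\overline{H'}$. Sums and products of ordinals are ordinal addition and ordinal multiplication.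
   Formalization: The space A∪B is additionally assumed to be T1; without a separation axiom the claim is false, e.g. for the two-point indiscrete space with A and B its two singletons, and T0 is not enough either. *)

theory Defs
  imports "HOL-Analysis.Analysis"
begin

text \<open>
  An ordinal is represented by a well-order relation (reflexive, as in the library), taken up to
  \<^const>\<open>ordIso\<close>; ordinals are compared by \<^const>\<open>ordLeq\<close> and \<^const>\<open>ordLess\<close>, which relate
  well-orders on possibly different types.
\<close>

definition ordinal_sum :: "'a rel \<Rightarrow> 'b rel \<Rightarrow> ('a + 'b) rel" where
  "ordinal_sum r s =
     {(Inl x, Inl x') | x x'. (x, x') \<in> r} \<union>
     {(Inl x, Inr y) | x y. x \<in> Field r \<and> y \<in> Field s} \<union>
     {(Inr y, Inr y') | y y'. (y, y') \<in> s}"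

text \<open>
  The ordinal product \<open>r \<cdot> s\<close> is \<open>s\<close> many copies of \<open>r\<close>, so the second coordinate is the more
  significant one.
\<close>

definition ordinal_prod :: "'a rel \<Rightarrow> 'b rel \<Rightarrow> ('a \<times> 'b) rel" where
  "ordinal_prod r s =
     {((x, y), (x', y')). x \<in> Field r \<and> x' \<in> Field r \<and>
        ((y, y') \<in> s \<and> y \<noteq> y' \<or> y = y' \<and> y \<in> Field s \<and> (x, x') \<in> r)}"

text \<open>\<open>\<omega>\<close> is \<^const>\<open>natLeq\<close>. Cardinals are initial ordinals, so \<open>\<omega>\<^sub>1\<close> is the successor cardinal of \<open>\<omega>\<close>.\<close>

definition omega1 :: "nat set rel" where
  "omega1 = cardSuc natLeq"

definition left_separating :: "'a topology \<Rightarrow> 'a rel \<Rightarrow> bool" where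
  "left_separating X r \<longleftrightarrow>
     well_order_on (topspace X) r \<and>
     (\<forall>y \<in> topspace X. closedin X {x \<in> topspace X. (x, y) \<in> r \<and> x \<noteq> y})"

definition left_separated :: "'a topology \<Rightarrow> bool" where
  "left_separated X \<longleftrightarrow> (\<exists>r. left_separating X r)"

text \<open>
  The left-separating type is only meaningful for left-separated spaces. Being an order type, it is
  determined up to \<^const>\<open>ordIso\<close>; the choice operator picks a left-separating well-ordering that
  attains the minimum.
\<close>

definition ord_left :: "'a topology \<Rightarrow> 'a rel" where
  "ord_left X =
     (SOME r. left_separating X r \<and> (\<forall>s. left_separating X s \<longrightarrow> (r, s) \<in> ordLeq))"

definition countably_tight :: "'a topology \<Rightarrow> bool" where
  "countably_tight X \<longleftrightarrow>
     (\<forall>H x. H \<subseteq> topspace X \<and> x \<in> X closure_of H \<longrightarrow>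
        (\<exists>H'. H' \<subseteq> H \<and> countable H' \<and> x \<in> X closure_of H'))"

end

theory Submission
  imports Defs "HOL-Library.Countable_Set_Type"
begin

text \<open>
  An ordinal lies below \<open>\<omega>\<^sub>1 \<cdot> \<omega>\<close> exactly when it can be cut into finitely many consecutive layers in
  which every initial segment is countable. The hypothesis on \<open>ord\<^sub>\<ell>(A) + ord\<^sub>\<ell>(B)\<close> therefore turns
  \<open>A \<union> B\<close> into a union of a finite family \<open>\<C>\<close> of subspaces, each left-separated by a well-ordering
  with countable initial segments. The heart of the proof is
  \<open>finite_union_omega1_left_separated\<close>, which treats such finite unions.

  Fix left-separating orders \<open>r\<^sub>C\<close> of the pieces, and let \<open>K(x)\<close> be the set of those \<open>C \<in> \<C>\<close> whose
  closure contains \<open>x\<close>. Two observations produce the required ordering.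

  \<^item> A point \<open>y\<close> has a neighbourhood on which \<open>K\<close> takes only subsets of \<open>K(y)\<close>. So \<open>y\<close> is not in
    the closure of \<open>{x. \<not> K(x) \<subseteq> K(y)}\<close>, and points with larger \<open>K\<close> may come first.

  \<^item> Suppose that \<open>M\<close> contains, with each point \<open>x\<close>, its predecessors in every \<open>r\<^sub>C\<close> and, for each
    \<open>C \<in> K(x)\<close>, a countable subset of \<open>C\<close> with \<open>x\<close> in its closure (this is countable tightness).
    Let \<open>y \<notin> M\<close>. Then \<open>y\<close> is not in the closure of \<open>{x \<in> M. K(x) = K(y)}\<close>: choose \<open>C\<close>
    with \<open>y \<in> C\<close>; then \<open>C \<in> K(x)\<close>, so all these \<open>x\<close> lie in the closure of \<open>M \<inter> C\<close>, and \<open>M \<inter> C\<close>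
    precedes \<open>y\<close> in \<open>r\<^sub>C\<close>, so its closure misses \<open>y\<close>.

  The closing-off demands are countable at each point and the space has at most \<open>\<aleph>\<^sub>1\<close> points, so there
  is a well-ordering \<open>q\<close> with countable initial segments such that the predecessors of any \<open>y\<close> are
  covered by a set \<open>M\<close> as above, with \<open>y \<notin> M\<close>, and a finite set (\<open>closing_off_well_order\<close>).
  Finite sets are harmless in a \<open>T\<^sub>1\<close> space. Ordering first by \<open>K\<close>, larger sets first, and then by \<open>q\<close> gives a left-separating well-ordering of the
  whole space. It has at most \<open>2\<^bsup>card \<C>\<^esup>\<close> layers with countable initial segments, hence order type
  below \<open>\<omega>\<^sub>1 \<cdot> \<omega>\<close>.
\<close>

unbundle cardinal_syntax

section \<open>Lexicographic well-orderings\<close>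

text \<open>
  The relation \<open>q\<close> only has to well-order the fibres of \<open>f\<close>; it may relate points of different
  fibres in any way. This covers the ordinal product as well as both refinements used to build the
  final ordering.
\<close>

lemma well_order_on_lex:
  assumes w: "well_order_on T w"
    and f: "\<And>x. x \<in> S \<Longrightarrow> f x \<in> T"
    and q: "\<And>t. t \<in> T \<Longrightarrow> well_order_on {x \<in> S. f x = t} (Restr q {x \<in> S. f x = t})"
  shows "well_order_on S
    {(x, y). x \<in> S \<and> y \<in> S \<and> ((f x, f y) \<in> w \<and> f x \<noteq> f y \<or> f x = f y \<and> (x, y) \<in> q)}"
    (is "well_order_on S ?s")
proof -
  have wtrans: "trans w" and wanti: "antisym w" and wtot: "total_on T w" and wwf: "wf (w - Id)"
    using w by (auto simp: order_on_defs)
  have qrefl: "(x, x) \<in> q" if "x \<in> S" for x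
    using q[OF f[OF that]] that by (auto simp: order_on_defs refl_on_def)
  have qtrans: "(x, z) \<in> q" if "x \<in> S" "y \<in> S" "z \<in> S" "f x = f y" "f y = f z" "(x, y) \<in> q" "(y, z) \<in> q"
    for x y z
  proof -
    have "trans (Restr q {u \<in> S. f u = f x})"
      using q[OF f[OF that(1)]] by (auto simp: order_on_defs)
    from transD[OF this, of x y z] show ?thesis using that by simp
  qed
  have qanti: "x = y" if "x \<in> S" "y \<in> S" "f x = f y" "(x, y) \<in> q" "(y, x) \<in> q" for x y
  proof -
    have "antisym (Restr q {u \<in> S. f u = f x})"
      using q[OF f[OF that(1)]] by (auto simp: order_on_defs)
    from antisymD[OF this, of x y] show ?thesis using that by simp
  qed
  have qtot: "(x, y) \<in> q \<or> (y, x) \<in> q" if "x \<in> S" "y \<in> S" "f x = f y" for x y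
  proof (cases "x = y")
    case False
    have "total_on {u \<in> S. f u = f x} (Restr q {u \<in> S. f u = f x})"
      using q[OF f[OF that(1)]] by (auto simp: order_on_defs)
    from this[unfolded total_on_def] show ?thesis using that False by auto
  qed (use qrefl that in auto)
  have "refl_on S ?s"
    using qrefl by (auto simp: refl_on_def)
  moreover have "trans ?s"
  proof (rule transI)
    fix x y z assume xy: "(x, y) \<in> ?s" and yz: "(y, z) \<in> ?s"
    then consider "f x = f y" "f y = f z" | "f x = f y" "f y \<noteq> f z" | "f x \<noteq> f y" "f y = f z"
      | "f x \<noteq> f y" "f y \<noteq> f z" "(f x, f z) \<in> w" "f x \<noteq> f z"
      using transD[OF wtrans, of "f x" "f y" "f z"] antisymD[OF wanti, of "f x" "f y"] by force
    then show "(x, z) \<in> ?s"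
      using xy yz qtrans[of x y z] by cases auto
  qed
  moreover have "antisym ?s"
  proof (rule antisymI)
    fix x y assume "(x, y) \<in> ?s" "(y, x) \<in> ?s"
    then show "x = y"
      using qanti[of x y] antisymD[OF wanti, of "f x" "f y"] by auto
  qed
  moreover have "total_on S ?s"
  proof (rule total_onI)
    fix x y assume "x \<in> S" "y \<in> S"
    then show "(x, y) \<in> ?s \<or> (y, x) \<in> ?s"
      using qtot[of x y] wtot[unfolded total_on_def] f by fastforce
  qed
  moreover have "wf (?s - Id)"
  proof (rule wfI_min)
    fix z Q assume z: "z \<in> (Q :: 'b set)"
    show "\<exists>z \<in> Q. \<forall>y. (y, z) \<in> ?s - Id \<longrightarrow> y \<notin> Q"
    proof (cases "Q \<inter> S = {}")
      case True
      then show ?thesis using z by auto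
    next
      case False
      then obtain t where t: "t \<in> f ` (Q \<inter> S)" and tmin: "\<And>u. (u, t) \<in> w - Id \<Longrightarrow> u \<notin> f ` (Q \<inter> S)"
        using wfE_min[OF wwf] by (metis image_is_empty ex_in_conv)
      \<comment> \<open>Having minimised the more significant key, minimise in its fibre.\<close>
      have "t \<in> T" using t f by auto
      then have "wf (Restr q {x \<in> S. f x = t} - Id)"
        using q by (auto simp: order_on_defs)
      moreover obtain x0 where "x0 \<in> {x \<in> Q \<inter> S. f x = t}" using t by auto
      ultimately obtain x where x: "x \<in> {x \<in> Q \<inter> S. f x = t}"
        and xmin: "\<And>u. (u, x) \<in> Restr q {x \<in> S. f x = t} - Id \<Longrightarrow> u \<notin> {x \<in> Q \<inter> S. f x = t}"
        by (rule wfE_min) blast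
      have "y \<notin> Q" if "(y, x) \<in> ?s - Id" for y
        using that x xmin[of y] tmin[of "f y"] by auto
      then show ?thesis using x by auto
    qed
  qed
  moreover have "?s \<subseteq> S \<times> S" by auto
  ultimately show ?thesis
    unfolding order_on_defs by blast
qed

lemma well_order_on_inv_image:
  assumes w: "well_order_on T w" and f: "inj_on f S" "f ` S \<subseteq> T"
  shows "well_order_on S (Restr (inv_image w f) S)"
proof -
  have w': "refl_on T w" "trans w" "antisym w" "total_on T w" "wf (w - Id)"
    using w by (auto simp: order_on_defs)
  have "refl_on S (Restr (inv_image w f) S)"
    using w'(1) f(2) by (auto simp: refl_on_def)
  moreover have "trans (Restr (inv_image w f) S)"
    by (intro trans_Restr trans_inv_image w'(2))
  moreover have "antisym (Restr (inv_image w f) S)"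
    by (rule antisymI) (use f(1) antisymD[OF w'(3)] in \<open>auto dest: inj_onD\<close>)
  moreover have "total_on S (Restr (inv_image w f) S)"
    unfolding total_on_def
  proof (intro ballI impI)
    fix x y assume xy: "x \<in> S" "y \<in> S" "x \<noteq> y"
    then have "f x \<in> T" "f y \<in> T" "f x \<noteq> f y"
      using f by (auto dest: inj_onD)
    with w'(4) have "(f x, f y) \<in> w \<or> (f y, f x) \<in> w"
      unfolding total_on_def by blast
    then show "(x, y) \<in> Restr (inv_image w f) S \<or> (y, x) \<in> Restr (inv_image w f) S"
      using xy by simp
  qed
  moreover have "wf (Restr (inv_image w f) S - Id)"
    by (rule wf_subset[OF wf_inv_image[OF w'(5), of f]]) (use f(1) in \<open>auto dest: inj_onD\<close>)
  ultimately show ?thesis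
    unfolding order_on_defs by blast
qed

section \<open>Countable initial segments and the ordinals below \<open>\<omega>\<^sub>1 \<cdot> \<omega>\<close>\<close>

text \<open>
  For well-orders this says that the order type is at most \<open>\<omega>\<^sub>1\<close>. Stated in this form it passes
  directly to restrictions.
\<close>

definition countable_initial_segments :: "'a rel \<Rightarrow> bool" where
  "countable_initial_segments r \<longleftrightarrow> (\<forall>y. countable (under r y))"

lemma omega1_Card_order: "Card_order omega1"
  unfolding omega1_def using natLeq_Card_order by (rule cardSuc_Card_order)

lemma omega1_uncountable: "uncountable (Field omega1)"
proof
  assume "countable (Field omega1)"
  then have "|Field omega1| \<le>o natLeq" by (simp add: countable_card_le_natLeq)
  moreover have "(card_of (Field omega1), omega1) \<in> ordIso" using omega1_Card_order by (rule card_of_Field_ordIso)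
  moreover have "natLeq <o omega1" unfolding omega1_def by (rule cardSuc_greater[OF natLeq_Card_order])
  ultimately show False
    by (meson not_ordLess_ordLeq ordIso_ordLeq_trans ordIso_symmetric)
qed

lemma countable_iff_less_omega1: "countable S \<longleftrightarrow> |S| <o omega1"
  unfolding countable_card_le_natLeq omega1_def
  using cardSuc_ordLeq_ordLess[OF natLeq_Card_order card_of_Card_order] by blast

lemma initial_segments_le_omega1:
  assumes r: "Card_order r" "r \<le>o omega1"
  shows "countable_initial_segments r"
  unfolding countable_initial_segments_def
proof
  fix y
  have "countable (underS r y)"
  proof (cases "y \<in> Field r")
    case True
    then show ?thesis
      using card_of_underS[OF r(1)] r(2) ordLess_ordLeq_trans
      by (auto simp: countable_iff_less_omega1)
  next
    case False
    then show ?thesis by (simp add: underS_empty)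
  qed
  moreover have "under r y \<subseteq> insert y (underS r y)"
    by (auto simp: under_def underS_def)
  ultimately show "countable (under r y)"
    by (meson countable_insert countable_subset)
qed

text \<open>
  Otherwise \<open>\<omega>\<^sub>1\<close>, being smaller than the cardinal of \<open>S\<close>, would be isomorphic to a proper initial
  segment of \<open>r\<close>, which is countable.
\<close>

lemma countable_initial_segments_card:
  assumes r: "well_order_on S r" "countable_initial_segments r"
  shows "|S| \<le>o omega1"
proof (rule ccontr)
  assume "\<not> |S| \<le>o omega1"
  then have "omega1 <o |S|"
    using omega1_Card_order card_of_Well_order[of S] not_ordLeq_iff_ordLess
    unfolding card_order_on_def by blast
  then have "omega1 <o r"
    using card_of_least[OF r(1)] ordLess_ordLeq_trans by blast
  then obtain a where "(omega1, Restr r (underS r a)) \<in> ordIso"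
    using ordLess_iff_ordIso_Restr[of r omega1] unfolding ordLess_def by auto
  then obtain f where "bij_betw f (Field omega1) (Field (Restr r (underS r a)))"
    by (auto simp: ordIso_def iso_def)
  moreover have "countable (Field (Restr r (underS r a)))"
  proof (rule countable_subset)
    show "Field (Restr r (underS r a)) \<subseteq> under r a"
      by (auto simp: Field_def under_def underS_def)
    show "countable (under r a)" using r(2) by (simp add: countable_initial_segments_def)
  qed
  ultimately show False using omega1_uncountable by (metis countable_iff_bij)
qed

text \<open>
  The function \<open>h\<close> cuts \<open>r\<close> into at most \<open>N + 1\<close> consecutive layers, each of order type at most
  \<open>\<omega>\<^sub>1\<close>. For a well-order, admitting such an \<open>h\<close> is equivalent to being below \<open>\<omega>\<^sub>1 \<cdot> \<omega>\<close>; the two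
  directions follow.
\<close>

definition omega1_layering :: "'a rel \<Rightarrow> ('a \<Rightarrow> nat) \<Rightarrow> nat \<Rightarrow> bool" where
  "omega1_layering r h N \<longleftrightarrow>
     (\<forall>x y. (x, y) \<in> r \<longrightarrow> h x \<le> h y) \<and>
     (\<forall>x \<in> Field r. h x \<le> N) \<and>
     (\<forall>y. countable {x. (x, y) \<in> r \<and> h x = h y})"

lemma well_order_on_ordinal_prod:
  assumes r: "Well_order r" and s: "Well_order s"
  shows "well_order_on (Field r \<times> Field s) (ordinal_prod r s)"
proof -
  let ?S = "Field r \<times> Field s"
  let ?q = "inv_image r fst"
  have "well_order_on ?S {(x, y). x \<in> ?S \<and> y \<in> ?S \<and>
      ((snd x, snd y) \<in> s \<and> snd x \<noteq> snd y \<or> snd x = snd y \<and> (x, y) \<in> ?q)}"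
  proof (rule well_order_on_lex[OF s])
    show "well_order_on {p \<in> ?S. snd p = t} (Restr ?q {p \<in> ?S. snd p = t})" for t
      by (rule well_order_on_inv_image[OF r]) (auto simp: inj_on_def)
  qed auto
  also have "{(x, y). x \<in> ?S \<and> y \<in> ?S \<and>
      ((snd x, snd y) \<in> s \<and> snd x \<noteq> snd y \<or> snd x = snd y \<and> (x, y) \<in> ?q)} = ordinal_prod r s"
    by (fastforce simp: ordinal_prod_def Field_def)
  finally show ?thesis .
qed

lemma omega1_omega:
  shows Well_order_omega1_omega: "Well_order (ordinal_prod omega1 natLeq)"
    and Field_omega1_omega: "Field (ordinal_prod omega1 natLeq) = Field omega1 \<times> UNIV"
proof -
  have "well_order_on (Field omega1 \<times> Field natLeq) (ordinal_prod omega1 natLeq)"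
    using omega1_Card_order natLeq_Well_order
    by (intro well_order_on_ordinal_prod) (auto simp: card_order_on_def)
  then show "Well_order (ordinal_prod omega1 natLeq)"
    "Field (ordinal_prod omega1 natLeq) = Field omega1 \<times> UNIV"
    using well_order_on_Well_order by (auto simp: Field_natLeq)
qed

text \<open>
  An isomorphism onto a proper initial segment of \<open>\<omega>\<^sub>1 \<cdot> \<omega>\<close> is available; its second coordinate is
  the layering, bounded because the segment is proper.
\<close>

lemma less_omega1_omega_imp_layering:
  assumes "r <o ordinal_prod omega1 natLeq"
  shows "\<exists>h N. omega1_layering r h N"
proof -
  let ?P = "ordinal_prod omega1 natLeq"
  obtain p where p: "p \<in> Field ?P" "(r, Restr ?P (underS ?P p)) \<in> ordIso"
    using assms ordLess_iff_ordIso_Restr[of ?P r] unfolding ordLess_def by auto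
  then obtain f where wo: "Well_order r" "Well_order (Restr ?P (underS ?P p))"
    and f: "iso r (Restr ?P (underS ?P p)) f"
    by (auto simp: ordIso_def)
  then have inj: "inj_on f (Field r)" and compat: "\<And>x y. (x, y) \<in> r \<Longrightarrow> (f x, f y) \<in> Restr ?P (underS ?P p)"
    using iso_iff3[OF wo] by (auto simp: bij_betw_def compat_def)
  have mono: "snd (f x) \<le> snd (f y)" if "(x, y) \<in> r" for x y
    using compat[OF that] by (auto simp: ordinal_prod_def natLeq_def)
  have bound: "snd (f x) \<le> snd p" if "x \<in> Field r" for x
  proof -
    have "(x, x) \<in> r" using wo(1) that by (auto simp: order_on_defs refl_on_def)
    then show ?thesis
      using compat[of x x] by (auto simp: ordinal_prod_def natLeq_def underS_def)
  qed
  have "countable {x. (x, y) \<in> r \<and> snd (f x) = snd (f y)}" (is "countable ?E") for y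
  proof -
    have "f ` ?E \<subseteq> under omega1 (fst (f y)) \<times> {snd (f y)}"
      using compat by (fastforce simp: ordinal_prod_def under_def)
    moreover have "countable (under omega1 (fst (f y)))"
      using initial_segments_le_omega1[OF omega1_Card_order] omega1_Card_order
      by (auto simp: countable_initial_segments_def card_order_on_def ordLeq_reflexive)
    ultimately have "countable (f ` ?E)"
      by (meson countable_SIGMA countable_subset countable_finite finite.intros)
    moreover have "inj_on f ?E" by (rule inj_on_subset[OF inj]) (auto simp: Field_def)
    ultimately show ?thesis by (rule countable_image_inj_on)
  qed
  with mono bound have "omega1_layering r (\<lambda>x. snd (f x)) (snd p)"
    unfolding omega1_layering_def by blast
  then show ?thesis by blast
qed

text \<open>
  A copy of \<open>\<omega>\<^sub>1 \<cdot> \<omega>\<close> inside \<open>r\<close> would need infinitely many layers: when passing from one copy of \<open>\<omega>\<^sub>1\<close>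
  to the next the layer has to grow, since otherwise an uncountable set would precede a point of
  its own layer.
\<close>

lemma layering_imp_less_omega1_omega:
  assumes r: "Well_order r" and h: "omega1_layering r h N"
  shows "r <o ordinal_prod omega1 natLeq"
proof (rule ccontr)
  let ?P = "ordinal_prod omega1 natLeq"
  assume "\<not> r <o ?P"
  then have "?P \<le>o r" using r Well_order_omega1_omega not_ordLess_iff_ordLeq by blast
  then obtain g where "embed ?P r g" by (auto simp: ordLeq_def)
  then have inj: "inj_on g (Field ?P)" and compat: "\<And>p p'. (p, p') \<in> ?P \<Longrightarrow> (g p, g p') \<in> r"
    using embed_inj_on[OF Well_order_omega1_omega] embed_compat unfolding compat_def by blast+
  have below: "(g (b, k), g (a, Suc k)) \<in> r" if "a \<in> Field omega1" "b \<in> Field omega1" for a b k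
    using that by (intro compat) (auto simp: ordinal_prod_def natLeq_def Field_natLeq[unfolded natLeq_def])
  have mono: "\<And>x y. (x, y) \<in> r \<Longrightarrow> h x \<le> h y" and count: "\<And>y. countable {x. (x, y) \<in> r \<and> h x = h y}"
    and bound: "\<And>x. x \<in> Field r \<Longrightarrow> h x \<le> N"
    using h by (auto simp: omega1_layering_def)
  \<comment> \<open>The claim is for all \<open>a\<close>, so that a whole copy of \<open>\<omega>\<^sub>1\<close> is trapped in one layer if it fails.\<close>
  have ge: "k \<le> h (g (a, k))" if "a \<in> Field omega1" for a k
    using that
  proof (induction k arbitrary: a)
    case (Suc k)
    show ?case
    proof (rule ccontr)
      assume "\<not> Suc k \<le> h (g (a, Suc k))"
      then have same: "h (g (b, k)) = h (g (a, Suc k))" if "b \<in> Field omega1" for b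
        using mono[OF below[OF Suc.prems that, of k]] Suc.IH[OF that] by simp
      have "(\<lambda>b. g (b, k)) ` Field omega1 \<subseteq> {x. (x, g (a, Suc k)) \<in> r \<and> h x = h (g (a, Suc k))}"
        using below[OF Suc.prems] same by blast
      then have "countable ((\<lambda>b. g (b, k)) ` Field omega1)"
        using count countable_subset by blast
      moreover have "inj_on (\<lambda>b. g (b, k)) (Field omega1)"
        using inj by (auto simp: inj_on_def Field_omega1_omega)
      ultimately show False
        using omega1_uncountable countable_image_inj_on by blast
    qed
  qed simp
  obtain a where a: "a \<in> Field omega1"
    using omega1_uncountable by fastforce
  have "g (a, Suc N) \<in> Field r"
    using below[OF a a] by (auto simp: Field_def)
  then show False
    using ge[OF a, of "Suc N"] bound by fastforce
qed

text \<open>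
  The bound on the sum reaches the summands through layerings: a layering of the sum restricts to
  both of them.
\<close>

lemma ordinal_sum_less_omega1_omega_imp_layerings:
  assumes r: "well_order_on A r" and s: "well_order_on B s"
    and less: "ordinal_sum r s <o ordinal_prod omega1 natLeq"
  obtains h N k M where "omega1_layering r h N" "omega1_layering s k M"
proof -
  obtain h N where h: "omega1_layering (ordinal_sum r s) h N"
    using less_omega1_omega_imp_layering[OF less] by blast
  have r_sub: "(Inl x, Inl y) \<in> ordinal_sum r s \<longleftrightarrow> (x, y) \<in> r" for x y
    by (auto simp: ordinal_sum_def)
  have s_sub: "(Inr x, Inr y) \<in> ordinal_sum r s \<longleftrightarrow> (x, y) \<in> s" for x y
    by (auto simp: ordinal_sum_def)
  have "countable {x. (x, y) \<in> r \<and> h (Inl x) = h (Inl y)}" for y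
  proof -
    have "Inl ` {x. (x, y) \<in> r \<and> h (Inl x) = h (Inl y)} \<subseteq>
        {z. (z, Inl y) \<in> ordinal_sum r s \<and> h z = h (Inl y)}"
      by (auto simp: r_sub)
    moreover have "countable {z. (z, Inl y) \<in> ordinal_sum r s \<and> h z = h (Inl y)}"
      using h by (simp add: omega1_layering_def)
    ultimately show ?thesis
      by (rule countable_image_inj_on[OF countable_subset inj_Inl])
  qed
  moreover have "countable {x. (x, y) \<in> s \<and> h (Inr x) = h (Inr y)}" for y
  proof -
    have "Inr ` {x. (x, y) \<in> s \<and> h (Inr x) = h (Inr y)} \<subseteq>
        {z. (z, Inr y) \<in> ordinal_sum r s \<and> h z = h (Inr y)}"
      by (auto simp: s_sub)
    moreover have "countable {z. (z, Inr y) \<in> ordinal_sum r s \<and> h z = h (Inr y)}"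
      using h by (simp add: omega1_layering_def)
    ultimately show ?thesis
      by (rule countable_image_inj_on[OF countable_subset inj_Inr])
  qed
  moreover have "Inl x \<in> Field (ordinal_sum r s)" if "x \<in> Field r" for x
    using that r_sub by (auto simp: Field_def)
  moreover have "Inr x \<in> Field (ordinal_sum r s)" if "x \<in> Field s" for x
    using that s_sub by (auto simp: Field_def)
  ultimately have "omega1_layering r (h \<circ> Inl) N" "omega1_layering s (h \<circ> Inr) N"
    using h r_sub s_sub unfolding omega1_layering_def by auto
  then show ?thesis by (rule that)
qed

section \<open>Closing off under countably many demands\<close>

text \<open>
  Every set \<open>c x\<close> is a demand: \<open>M\<close> is closed off if it contains \<open>c x\<close> whenever it contains \<open>x\<close>. Closing
  a single point off under \<open>c\<close> takes only countably many points. Enumerate \<open>S\<close> in order type at most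
  \<open>\<omega>\<^sub>1\<close>, let the level \<open>l x\<close> of a point be the first \<open>j\<close> whose closure under \<open>c\<close> contains \<open>x\<close>, and
  list each (countable) level in type at most \<open>\<omega>\<close>. The points of level below \<open>l y\<close> form a closed-off
  set, and only finitely many further points precede \<open>y\<close>.
\<close>

lemma closing_off_well_order:
  assumes S: "|S| \<le>o omega1"
    and c: "\<And>x. x \<in> S \<Longrightarrow> countable (c x)" "\<And>x. x \<in> S \<Longrightarrow> c x \<subseteq> S"
  obtains q where "well_order_on S q" "countable_initial_segments q"
    "\<And>y. y \<in> S \<Longrightarrow> \<exists>M \<subseteq> S. y \<notin> M \<and> (\<forall>x \<in> M. c x \<subseteq> M) \<and> finite (underS q y - M)"
proof -
  \<comment> \<open>A cardinal of size at most \<open>\<aleph>\<^sub>1\<close> enumerates \<open>S\<close> with countable initial segments.\<close>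
  define w where "w = card_of S"
  have w: "well_order_on S w"
    unfolding w_def by (rule card_of_well_order_on)
  have w_trans: "trans w" and w_antisym: "antisym w" and w_total: "total_on S w"
    and w_refl: "refl_on S w" and w_wf: "wf (w - Id)"
    using w by (auto simp: order_on_defs)
  have w_countable: "countable (under w j)" for j
    using initial_segments_le_omega1[OF card_of_Card_order S]
    by (simp add: countable_initial_segments_def w_def)
  define T where "T = {(x, z). x \<in> S \<and> z \<in> c x}"
  define orbit where "orbit j = T\<^sup>* `` {j}" for j
  have T_countable: "countable (T `` Y)" if "countable Y" for Y
  proof -
    have "T `` Y = (\<Union>x \<in> Y \<inter> S. c x)" by (auto simp: T_def)
    then show ?thesis using that c(1) by auto
  qed
  have orbit_countable: "countable (orbit j)" for j
    unfolding orbit_def by (intro countable_rtrancl T_countable) auto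
  have orbit_closed: "c x \<subseteq> orbit j" if "x \<in> orbit j" "x \<in> S" for x j
    using that unfolding orbit_def T_def by (auto intro: rtrancl_into_rtrancl)
  have "\<exists>j. j \<in> S \<and> x \<in> orbit j \<and> (\<forall>k \<in> S. x \<in> orbit k \<longrightarrow> (j, k) \<in> w)" if x: "x \<in> S" for x
  proof -
    have "x \<in> {j \<in> S. x \<in> orbit j}" using x by (auto simp: orbit_def)
    then obtain j where j: "j \<in> {j \<in> S. x \<in> orbit j}"
      and min: "\<And>k. (k, j) \<in> w - Id \<Longrightarrow> k \<notin> {j \<in> S. x \<in> orbit j}"
      by (rule wfE_min[OF w_wf]) blast
    have "(j, k) \<in> w" if k: "k \<in> S" "x \<in> orbit k" for k
    proof (cases "j = k")
      case True
      then show ?thesis using w_refl k by (auto simp: refl_on_def)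
    next
      case False
      then show ?thesis using w_total[unfolded total_on_def] min[of k] k j by auto
    qed
    then show ?thesis using j by blast
  qed
  then obtain l where l: "\<And>x. x \<in> S \<Longrightarrow> l x \<in> S" "\<And>x. x \<in> S \<Longrightarrow> x \<in> orbit (l x)"
    and l_least: "\<And>x k. x \<in> S \<Longrightarrow> k \<in> S \<Longrightarrow> x \<in> orbit k \<Longrightarrow> (l x, k) \<in> w"
    by metis
  define e where "e x = to_nat_on (orbit (l x)) x" for x
  have e_inj: "inj_on e {x \<in> S. l x = j}" for j
  proof (rule inj_onI)
    fix x y assume xy: "x \<in> {x \<in> S. l x = j}" "y \<in> {x \<in> S. l x = j}" "e x = e y"
    then have "x \<in> orbit j" "y \<in> orbit j"
      using l(2)[of x] l(2)[of y] by auto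
    then show "x = y"
      using inj_onD[OF inj_on_to_nat_on[OF orbit_countable], of j x y] xy by (simp add: e_def)
  qed
  define q where "q = {(x, y). x \<in> S \<and> y \<in> S \<and>
    ((l x, l y) \<in> w \<and> l x \<noteq> l y \<or> l x = l y \<and> (x, y) \<in> inv_image natLeq e)}"
  have "well_order_on S q"
    unfolding q_def
  proof (rule well_order_on_lex[OF w l(1)])
    show "well_order_on {x \<in> S. l x = j} (Restr (inv_image natLeq e) {x \<in> S. l x = j})" for j
      by (rule well_order_on_inv_image[OF natLeq_Well_order e_inj]) (simp add: Field_natLeq)
  qed
  moreover have "countable_initial_segments q"
    unfolding countable_initial_segments_def
  proof
    fix y
    have "under q y \<subseteq> (\<Union>j \<in> under w (l y). orbit j)"
    proof
      fix x assume "x \<in> under q y"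
      then have x: "x \<in> S" "(l x, l y) \<in> w \<or> l x = l y"
        by (auto simp: under_def q_def)
      then have "(l x, l y) \<in> w"
        using refl_onD[OF w_refl l(1)[OF x(1)]] by metis
      then show "x \<in> (\<Union>j \<in> under w (l y). orbit j)"
        using l(2)[OF x(1)] by (auto simp: under_def)
    qed
    then show "countable (under q y)"
      by (rule countable_subset) (intro countable_UN w_countable orbit_countable)
  qed
  moreover have "\<exists>M \<subseteq> S. y \<notin> M \<and> (\<forall>x \<in> M. c x \<subseteq> M) \<and> finite (underS q y - M)" if y: "y \<in> S" for y
  proof (intro exI conjI ballI)
    let ?M = "{x \<in> S. (l x, l y) \<in> w \<and> l x \<noteq> l y}"
    show "?M \<subseteq> S" "y \<notin> ?M" by auto
    show "c x \<subseteq> ?M" if x: "x \<in> ?M" for x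
    proof
      fix z assume z: "z \<in> c x"
      have "z \<in> S" using x z c(2) by auto
      moreover have "(l z, l x) \<in> w"
        using x z orbit_closed[of x "l x"] l[of x] l_least[OF \<open>z \<in> S\<close>, of "l x"] by blast
      ultimately show "z \<in> ?M"
        using x transD[OF w_trans, of "l z" "l x" "l y"] antisymD[OF w_antisym, of "l x" "l y"] by auto
    qed
    let ?E = "{x \<in> S. l x = l y \<and> e x \<le> e y}"
    have "inj_on e ?E" by (rule inj_on_subset[OF e_inj[of "l y"]]) auto
    moreover have "finite (e ` ?E)" by (rule finite_subset[of _ "{..e y}"]) auto
    ultimately have "finite ?E" by (metis finite_imageD)
    then show "finite (underS q y - ?M)"
      by (rule finite_subset[rotated]) (auto simp: underS_def q_def natLeq_def)
  qed
  ultimately show ?thesis by (rule that)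
qed

section \<open>Left-separating well-orderings\<close>

text \<open>
  A point adherent to the predecessors of \<open>y\<close> without being one of them is \<open>y\<close> itself or comes after
  \<open>y\<close>, hence would be adherent to its own predecessors.
\<close>

lemma left_separatingI:
  assumes s: "well_order_on (topspace X) s"
    and away: "\<And>y. y \<in> topspace X \<Longrightarrow> y \<notin> X closure_of (underS s y)"
  shows "left_separating X s"
  unfolding left_separating_def
proof (intro conjI s ballI)
  fix y assume y: "y \<in> topspace X"
  have s': "trans s" "antisym s" "total_on (topspace X) s" "s \<subseteq> topspace X \<times> topspace X"
    using s by (auto simp: order_on_defs)
  have "X closure_of (underS s y) \<subseteq> underS s y"
  proof
    fix z assume z: "z \<in> X closure_of (underS s y)"
    have zX: "z \<in> topspace X" using z closure_of_subset_topspace by fastforce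
    show "z \<in> underS s y"
    proof (rule ccontr)
      assume "z \<notin> underS s y"
      then have "(y, z) \<in> s"
        using s'(3)[unfolded total_on_def, rule_format, OF zX y] s y zX
        by (auto simp: underS_def order_on_defs refl_on_def)
      then have "underS s y \<subseteq> underS s z"
        using s'(1,2) by (auto simp: underS_def dest: transD antisymD)
      then show False
        using z away[OF zX] closure_of_mono by blast
    qed
  qed
  moreover have "underS s y \<subseteq> topspace X"
    using s'(4) by (auto simp: underS_def)
  moreover have "{x \<in> topspace X. (x, y) \<in> s \<and> x \<noteq> y} = underS s y"
    using s'(4) by (auto simp: underS_def)
  ultimately show "closedin X {x \<in> topspace X. (x, y) \<in> s \<and> x \<noteq> y}"
    by (simp flip: closure_of_subset_eq)
qed

lemma not_in_closure_of_predecessors: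
  assumes r: "left_separating (subtopology X C) r" and y: "y \<in> topspace X" "y \<in> C"
    and D: "D \<subseteq> C \<inter> underS r y"
  shows "y \<notin> X closure_of D"
proof
  assume "y \<in> X closure_of D"
  let ?P = "{x \<in> topspace (subtopology X C). (x, y) \<in> r \<and> x \<noteq> y}"
  have "closedin (subtopology X C) ?P"
    using r y by (auto simp: left_separating_def)
  moreover have "y \<in> subtopology X C closure_of ?P"
  proof -
    have "y \<in> X closure_of (topspace X \<inter> D)"
      using \<open>y \<in> X closure_of D\<close> by (simp flip: closure_of_restrict)
    moreover have "topspace X \<inter> D \<subseteq> C \<inter> ?P"
      using D by (auto simp: underS_def)
    ultimately show ?thesis
      using y closure_of_mono[of "topspace X \<inter> D" "C \<inter> ?P" X]
      by (auto simp: closure_of_subtopology)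
  qed
  ultimately have "y \<in> ?P"
    by (simp only: closure_of_eq[THEN iffD2])
  then show False by simp
qed

lemma left_separating_Restr:
  assumes r: "left_separating (subtopology X C) r" and D: "D \<subseteq> C" "D \<subseteq> topspace X"
  shows "left_separating (subtopology X D) (Restr r D)"
proof (rule left_separatingI)
  have "well_order_on (topspace X \<inter> C) r"
    using r by (simp add: left_separating_def)
  then have "Well_order r" "Field r = topspace X \<inter> C"
    using well_order_on_Well_order by auto
  then have "well_order_on D (Restr r D)"
    using D by (intro well_order_on_Restr) auto
  then show "well_order_on (topspace (subtopology X D)) (Restr r D)"
    using D by (simp add: Int_absorb1)
next
  fix y assume "y \<in> topspace (subtopology X D)"
  then have y: "y \<in> topspace X" "y \<in> C" using D by auto
  have "y \<notin> X closure_of (D \<inter> underS (Restr r D) y)"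
    using D by (intro not_in_closure_of_predecessors[OF r y]) (auto simp: underS_def)
  then show "y \<notin> subtopology X D closure_of underS (Restr r D) y"
    by (simp add: closure_of_subtopology)
qed

text \<open>
  The minimum defining the left-separating type is attained because ordinals are well-ordered.
\<close>

lemma left_separating_ord_left:
  assumes "left_separated X"
  shows "left_separating X (ord_left X)" "left_separating X s \<Longrightarrow> ord_left X \<le>o s"
proof -
  let ?R = "{r. left_separating X r}"
  have "\<forall>r \<in> ?R. Well_order r"
    using well_order_on_Well_order by (auto simp: left_separating_def)
  moreover have "?R \<noteq> {}" using assms by (auto simp: left_separated_def)
  ultimately have "\<exists>r. left_separating X r \<and> (\<forall>s. left_separating X s \<longrightarrow> r \<le>o s)"
    using exists_minim_Well_order[of ?R] by auto
  from someI_ex[OF this] show "left_separating X (ord_left X)" "left_separating X s \<Longrightarrow> ord_left X \<le>o s"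
    unfolding ord_left_def by auto
qed

definition omega1_left_separated :: "'a topology \<Rightarrow> bool" where
  "omega1_left_separated X \<longleftrightarrow> (\<exists>r. left_separating X r \<and> countable_initial_segments r)"

text \<open>
  The pieces are the layers; a left-separating ordering restricts to each of them.
\<close>

lemma split_into_omega1_left_separated:
  assumes r: "left_separating (subtopology X C) r" and C: "C \<subseteq> topspace X"
    and h: "omega1_layering r h N"
  obtains \<C> where "finite \<C>" "\<Union>\<C> = C" "\<And>D. D \<in> \<C> \<Longrightarrow> omega1_left_separated (subtopology X D)"
proof (rule that)
  let ?D = "\<lambda>k. {x \<in> C. h x = k}"
  have "Field r = C"
    using r C well_order_on_Well_order[of "topspace (subtopology X C)" r]
    by (simp add: left_separating_def Int_absorb1)
  then show "\<Union>(?D ` {..N}) = C"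
    using h by (auto simp: omega1_layering_def)
  show "finite (?D ` {..N})" by simp
  show "omega1_left_separated (subtopology X D)" if mem: "D \<in> ?D ` {..N}" for D
  proof -
    obtain k where D: "D = ?D k" using mem by auto
    have "countable_initial_segments (Restr r D)"
      unfolding countable_initial_segments_def
    proof
      fix y
      have "under (Restr r D) y \<subseteq> {x. (x, y) \<in> r \<and> h x = h y}"
        by (auto simp: under_def D)
      moreover have "countable {x. (x, y) \<in> r \<and> h x = h y}"
        using h by (simp add: omega1_layering_def)
      ultimately show "countable (under (Restr r D) y)"
        by (rule countable_subset)
    qed
    moreover have "left_separating (subtopology X D) (Restr r D)"
      using C by (intro left_separating_Restr[OF r]) (auto simp: D)
    ultimately show ?thesis unfolding omega1_left_separated_def by blast
  qed
qed

section \<open>Finite unions\<close>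

text \<open>
  The linear order by \<open>h\<close> extends reverse inclusion on the subsets of \<open>\<C>\<close>.
\<close>

lemma larger_sets_first:
  assumes "finite \<C>"
  obtains h :: "'b set \<Rightarrow> nat" where "inj_on h (Pow \<C>)"
    "\<And>K K'. K' \<subseteq> \<C> \<Longrightarrow> K \<subset> K' \<Longrightarrow> h K' < h K"
proof -
  obtain e :: "'b set \<Rightarrow> nat" and n where e: "e ` Pow \<C> = {i. i < n}" "inj_on e (Pow \<C>)"
    using finite_imp_inj_to_nat_seg[of "Pow \<C>"] assms by auto
  have e_less: "e K < n" if "K \<subseteq> \<C>" for K using that e(1) by auto
  \<comment> \<open>Reversed cardinality is the leading digit in base \<open>n\<close>; the last digit \<open>e K < n\<close> makes \<open>h\<close> injective.\<close>
  define h where "h K = (card \<C> - card K) * n + e K" for K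
  show ?thesis
  proof (rule that[of h])
    have "e K = h K mod n" if "K \<subseteq> \<C>" for K
      using e_less[OF that] by (simp add: h_def)
    then show "inj_on h (Pow \<C>)"
      using e(2) by (auto simp: inj_on_def)
    show "h K' < h K" if K: "K' \<subseteq> \<C>" "K \<subset> K'" for K K'
    proof -
      have "card K < card K'" "card K' \<le> card \<C>"
        using K assms by (auto intro: psubset_card_mono card_mono finite_subset)
      then have "Suc (card \<C> - card K') \<le> card \<C> - card K" by simp
      then have "Suc (card \<C> - card K') * n \<le> (card \<C> - card K) * n" by (rule mult_le_mono1)
      then show ?thesis using e_less[OF K(1)] by (simp add: h_def)
    qed
  qed
qed

text \<open>
  Predecessors of a point \<open>y\<close> are of three kinds, each contained in a closed set that misses \<open>y\<close>: those
  with a different \<open>K\<close>-value lie in the closure of some piece whose closure misses \<open>y\<close>; those with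
  the same \<open>K\<close>-value in the closed-off set \<open>M\<close> lie in the closure of \<open>M \<inter> C\<close>, where \<open>C\<close> is a piece
  through \<open>y\<close>; the remaining ones are finite in number.
\<close>

lemma finite_union_omega1_left_separated:
  assumes T1: "t1_space X" and tight: "countably_tight X"
    and fin: "finite \<C>" and cover: "\<Union>\<C> = topspace X"
    and sep: "\<And>C. C \<in> \<C> \<Longrightarrow> omega1_left_separated (subtopology X C)"
  obtains s where "left_separating X s" "s <o ordinal_prod omega1 natLeq"
proof -
  have "\<forall>C \<in> \<C>. \<exists>r. left_separating (subtopology X C) r \<and> countable_initial_segments r"
    using sep by (auto simp: omega1_left_separated_def)
  then obtain r where r: "\<And>C. C \<in> \<C> \<Longrightarrow> left_separating (subtopology X C) (r C)"
    and r_countable: "\<And>C. C \<in> \<C> \<Longrightarrow> countable_initial_segments (r C)"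
    by metis
  have r_wo: "well_order_on C (r C)" if "C \<in> \<C>" for C
  proof -
    have "topspace (subtopology X C) = C" using that cover by auto
    then show ?thesis using r[OF that] by (simp add: left_separating_def)
  qed
  have "|\<Union>C \<in> \<C>. C| \<le>o omega1"
  proof (rule card_of_UNION_ordLeq_infinite_Field)
    show "infinite (Field omega1)" using omega1_uncountable countable_finite by blast
    show "|\<C>| \<le>o omega1"
      using fin omega1_Card_order countable_iff_less_omega1 ordLess_imp_ordLeq countable_finite by blast
    show "\<forall>C \<in> \<C>. |C| \<le>o omega1"
      using countable_initial_segments_card[OF r_wo r_countable] by blast
  qed (rule omega1_Card_order)
  then have card: "|topspace X| \<le>o omega1" using cover by simp

  have "\<exists>H'. H' \<subseteq> C \<and> countable H' \<and> x \<in> X closure_of H'" if "C \<in> \<C>" "x \<in> X closure_of C" for C x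
    using tight that cover unfolding countably_tight_def by blast
  then obtain H where H: "\<And>C x. C \<in> \<C> \<Longrightarrow> x \<in> X closure_of C \<Longrightarrow>
      H C x \<subseteq> C \<and> countable (H C x) \<and> x \<in> X closure_of H C x"
    by metis
  define K where "K x = {C \<in> \<C>. x \<in> X closure_of C}" for x
  define c where "c x = (\<Union>C \<in> K x. H C x) \<union> (\<Union>C \<in> \<C>. under (r C) x)" for x
  have "countable (c x)" for x
    unfolding c_def using fin H r_countable
    by (intro countable_Un countable_UN) (auto simp: K_def countable_initial_segments_def countable_finite)
  moreover have "c x \<subseteq> topspace X" for x
  proof -
    have "H C x \<subseteq> topspace X" if "C \<in> K x" for C
      using H[of C x] that cover by (auto simp: K_def)
    moreover have "under (r C) x \<subseteq> topspace X" if "C \<in> \<C>" for C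
      using r_wo[OF that] that cover by (fastforce simp: under_def order_on_defs)
    ultimately show ?thesis unfolding c_def by blast
  qed
  ultimately obtain q where q: "well_order_on (topspace X) q" "countable_initial_segments q"
    and closing: "\<And>y. y \<in> topspace X \<Longrightarrow>
      \<exists>M \<subseteq> topspace X. y \<notin> M \<and> (\<forall>x \<in> M. c x \<subseteq> M) \<and> finite (underS q y - M)"
    using closing_off_well_order[OF card, of c] by metis

  obtain h :: "'a set set \<Rightarrow> nat" where h_inj: "inj_on h (Pow \<C>)"
    and h_less: "\<And>K K'. K' \<subseteq> \<C> \<Longrightarrow> K \<subset> K' \<Longrightarrow> h K' < h K"
    using larger_sets_first[OF fin] by metis
  have K_sub: "K x \<subseteq> \<C>" for x by (auto simp: K_def)
  let ?g = "\<lambda>x. h (K x)"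
  define s where "s = {(x, y). x \<in> topspace X \<and> y \<in> topspace X \<and>
    ((?g x, ?g y) \<in> natLeq \<and> ?g x \<noteq> ?g y \<or> ?g x = ?g y \<and> (x, y) \<in> q)}"
  have s: "well_order_on (topspace X) s"
    unfolding s_def
  proof (rule well_order_on_lex)
    show "well_order_on UNIV natLeq"
      using natLeq_Well_order by (simp add: Field_natLeq)
    show "well_order_on {x \<in> topspace X. ?g x = t} (Restr q {x \<in> topspace X. ?g x = t})" for t
      using q(1) well_order_on_Well_order[OF q(1)] by (intro well_order_on_Restr) auto
  qed simp

  have "left_separating X s"
  proof (rule left_separatingI[OF s])
    fix y assume y: "y \<in> topspace X"
    obtain M where M: "M \<subseteq> topspace X" "y \<notin> M" "\<And>x. x \<in> M \<Longrightarrow> c x \<subseteq> M" "finite (underS q y - M)"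
      using closing[OF y] by blast
    obtain C where C: "C \<in> \<C>" "y \<in> C" using y cover by auto
    have CK: "C \<in> K y"
      using C cover closure_of_subset[of C X] by (auto simp: K_def)

    let ?Z = "\<Union>D \<in> \<C> - K y. X closure_of D"
    have Z: "closedin X ?Z" "y \<notin> ?Z"
    proof -
      show "closedin X ?Z" using fin by (intro closedin_Union) auto
      show "y \<notin> ?Z" by (auto simp: K_def)
    qed
    have earlier: "x \<in> ?Z" if "x \<in> topspace X" "?g x < ?g y" for x
    proof -
      have "\<not> K x \<subseteq> K y"
        using that(2) h_less[OF K_sub, of "K x" y] by (cases "K x = K y") auto
      then show ?thesis by (auto simp: K_def)
    qed

    \<comment> \<open>Since \<open>C \<in> K x\<close>, tightness at \<open>x\<close> is witnessed inside \<open>M \<inter> C\<close>.\<close>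
    have M_cl: "x \<in> X closure_of (M \<inter> C)" if "x \<in> M" "?g x = ?g y" for x
    proof -
      have "K x = K y" using that(2) inj_onD[OF h_inj] K_sub by blast
      then have "C \<in> K x" using CK by simp
      then have "H C x \<subseteq> M \<inter> C" "x \<in> X closure_of H C x"
        using H[of C x] M(3)[OF that(1)] by (auto simp: K_def c_def)
      then show ?thesis using closure_of_mono by blast
    qed
    \<comment> \<open>A point of \<open>M \<inter> C\<close> after \<open>y\<close> would force its predecessor \<open>y\<close> into \<open>M\<close>.\<close>
    have "M \<inter> C \<subseteq> C \<inter> underS (r C) y"
    proof
      fix x assume x: "x \<in> M \<inter> C"
      have "(y, x) \<notin> r C"
        using M(2) M(3)[of x] x C(1) by (auto simp: c_def under_def)
      then show "x \<in> C \<inter> underS (r C) y"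
        using r_wo[OF C(1)] x C(2) M(2) by (auto simp: order_on_defs total_on_def underS_def)
    qed
    from not_in_closure_of_predecessors[OF r[OF C(1)] y C(2) this]
    have M_away: "y \<notin> X closure_of (M \<inter> C)" .

    let ?F = "underS q y - M"
    have "?F \<subseteq> topspace X"
      using q(1) by (auto simp: underS_def order_on_defs)
    then have F: "closedin X ?F" "y \<notin> ?F"
      using t1_space_closedin_finite T1 M(4) by (auto simp: underS_def)

    have "underS s y \<subseteq> ?Z \<union> X closure_of (M \<inter> C) \<union> ?F"
    proof
      fix x assume "x \<in> underS s y"
      then consider "x \<in> topspace X" "?g x < ?g y" | "?g x = ?g y" "x \<in> underS q y"
        by (auto simp: underS_def s_def natLeq_def)
      then show "x \<in> ?Z \<union> X closure_of (M \<inter> C) \<union> ?F"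
        using earlier M_cl by cases blast+
    qed
    then have "X closure_of (underS s y) \<subseteq> ?Z \<union> X closure_of (M \<inter> C) \<union> ?F"
      by (rule closure_of_minimal) (intro closedin_Un Z F closedin_closure_of)
    then show "y \<notin> X closure_of (underS s y)"
      using Z(2) M_away F(2) by blast
  qed
  moreover have "s <o ordinal_prod omega1 natLeq"
  proof (rule layering_imp_less_omega1_omega)
    show "Well_order s" using well_order_on_Well_order[OF s] by simp
    have "countable {x. (x, y) \<in> s \<and> ?g x = ?g y}" for y
    proof (rule countable_subset)
      show "{x. (x, y) \<in> s \<and> ?g x = ?g y} \<subseteq> under q y"
        by (auto simp: s_def under_def)
      show "countable (under q y)"
        using q(2) by (simp add: countable_initial_segments_def)
    qed
    moreover have "?g x \<le> Max (h ` Pow \<C>)" for x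
      using fin K_sub by (intro Max_ge) auto
    moreover have "?g x \<le> ?g y" if "(x, y) \<in> s" for x y
      using that by (auto simp: s_def natLeq_def)
    ultimately show "omega1_layering s ?g (Max (h ` Pow \<C>))"
      unfolding omega1_layering_def by blast
  qed
  ultimately show ?thesis by (rule that)
qed

theorem theorem1p5:
  fixes X :: "'a topology" and A B :: "'a set"
  assumes "topspace X = A \<union> B"
    and "t1_space X"
    and "left_separated (subtopology X A)"
    and "left_separated (subtopology X B)"
    and "countably_tight X"
    and "(ordinal_sum (ord_left (subtopology X A)) (ord_left (subtopology X B)),
          ordinal_prod omega1 natLeq) \<in> ordLess"
  shows "left_separated X \<and> (ord_left X, ordinal_prod omega1 natLeq) \<in> ordLess"
proof -
  have A: "left_separating (subtopology X A) (ord_left (subtopology X A))" "A \<subseteq> topspace X"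
    and B: "left_separating (subtopology X B) (ord_left (subtopology X B))" "B \<subseteq> topspace X"
    using assms(1,3,4) by (auto intro: left_separating_ord_left)
  have woA: "well_order_on (topspace (subtopology X A)) (ord_left (subtopology X A))"
    and woB: "well_order_on (topspace (subtopology X B)) (ord_left (subtopology X B))"
    using A B by (auto simp only: left_separating_def)
  obtain h N k M where h: "omega1_layering (ord_left (subtopology X A)) h N"
    and k: "omega1_layering (ord_left (subtopology X B)) k M"
    using ordinal_sum_less_omega1_omega_imp_layerings[OF woA woB assms(6)] by blast
  obtain \<A> where \<A>: "finite \<A>" "\<Union>\<A> = A" "\<And>D. D \<in> \<A> \<Longrightarrow> omega1_left_separated (subtopology X D)"
    using split_into_omega1_left_separated[OF A h] by blast
  obtain \<B> where \<B>: "finite \<B>" "\<Union>\<B> = B" "\<And>D. D \<in> \<B> \<Longrightarrow> omega1_left_separated (subtopology X D)"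
    using split_into_omega1_left_separated[OF B k] by blast
  obtain s where s: "left_separating X s" "s <o ordinal_prod omega1 natLeq"
  proof (rule finite_union_omega1_left_separated[OF assms(2,5)])
    show "finite (\<A> \<union> \<B>)" "\<Union>(\<A> \<union> \<B>) = topspace X"
      using \<A> \<B> assms(1) by auto
  qed (use \<A> \<B> in blast)+
  then have "left_separated X" by (auto simp: left_separated_def)
  moreover have "ord_left X <o ordinal_prod omega1 natLeq"
    using left_separating_ord_left(2)[OF \<open>left_separated X\<close> s(1)] s(2) by (rule ordLeq_ordLess_trans)
  ultimately show ?thesis by simp
qed

end
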